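(* Let $n\geq 3$ and let $G\in\mathfrak{C}_{n,0}$, i.e. $G$ is a connected graph on $n$ vertices with no cut vertex. Then $\varepsilon(G)\leq n\left\lfloor\frac{n}{2}\right\rfloor$, and equality happens if $G\cong C_n$.
   Context: All graphs are finite, simple, connected and undirected. The eccentricity of a vertex $v$ of $G$ is $e_G(v)=\max\{d_G(v,u): u\in V(G)\}$, and the total eccentricity index is $\varepsilon(G)=\sum_{v\in V(G)}e_G(v)$. A vertex $w$ is a cut vertex of $G$ if $G-w$ is disconnected. $\mathfrak{C}_{n,s}$ is the set of all connected graphs on $n$ vertices with exactly $s$ cut vertices. $C_n$ is the cycle on $n$ vertices. *)

theory Defs
  imports "Graph_Theory.Graph_Theory"
begin

text \<open>
  Finite simple undirected graphs are the symmetric loop-free digraphs without multiple arcs of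
  the locale \<^locale>\<open>graph\<close>: an edge is represented by its two opposite arcs.
\<close>

text \<open>
  The graph distance is the shortest-path distance \<^const>\<open>wf_digraph.\<mu>\<close> with every arc
  having weight 1. It is extended-real valued, with value infinity between vertices of
  different components; in a connected graph it is the number of edges of a shortest path.
\<close>
definition graph_dist :: "('a, 'b) pre_digraph \<Rightarrow> 'a \<Rightarrow> 'a \<Rightarrow> ereal" where
  "graph_dist G u v = wf_digraph.\<mu> G (\<lambda>_. 1) u v"

definition eccentricity :: "('a, 'b) pre_digraph \<Rightarrow> 'a \<Rightarrow> ereal" where
  "eccentricity G v = Max {graph_dist G v u | u. u \<in> verts G}"

definition total_eccentricity :: "('a, 'b) pre_digraph \<Rightarrow> ereal" where
  "total_eccentricity G = (\<Sum>v\<in>verts G. eccentricity G v)"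

text \<open>
  \<^const>\<open>connected\<close> is false for the graph without vertices. That graph is not regarded as
  disconnected, so the vertex of a one-vertex graph is not a cut vertex.
\<close>
definition cut_vertex :: "('a, 'b) pre_digraph \<Rightarrow> 'a \<Rightarrow> bool" where
  "cut_vertex G w \<longleftrightarrow> w \<in> verts G \<and> verts (pre_digraph.del_vert G w) \<noteq> {} \<and>
     \<not> connected (pre_digraph.del_vert G w)"

definition cut_vertex_graphs :: "nat \<Rightarrow> nat \<Rightarrow> ('a, 'b) pre_digraph set" where
  "cut_vertex_graphs n s = {G. graph G \<and> connected G \<and> card (verts G) = n \<and>
     card {w. cut_vertex G w} = s}"

text \<open>The cycle on \<open>n\<close> vertices; only meaningful for \<open>n \<ge> 3\<close>.\<close>
definition cycle_graph :: "nat \<Rightarrow> (nat, nat \<times> nat) pre_digraph" where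
  "cycle_graph n = with_proj \<lparr> pverts = {..<n},
     parcs = {(i, j). i < n \<and> j < n \<and> (j = Suc i mod n \<or> i = Suc j mod n)} \<rparr>"

end

theory Submission
  imports Defs
begin

text \<open>
  The bound holds vertex by vertex: every eccentricity is at most \<open>n div 2\<close>. Sort the vertices by
  their number of hops from a vertex \<open>v\<close>, and let \<open>u\<close> be \<open>e\<close> hops away. Along an arc the number of
  hops changes by at most one, so a connected graph containing \<open>v\<close> and \<open>u\<close> meets every level between
  \<open>0\<close> and \<open>e\<close> (\<open>connected_meets_level\<close>). Without cut vertices, deleting a single vertex \<open>w\<close> from a level \<open>0 < i < e\<close> leaves a
  connected graph, which must still meet that level; hence the level has at least two vertices
  (\<open>inner_level_two_vertices\<close>). Together with \<open>v\<close> and \<open>u\<close> these are \<open>2 (e - 1) + 2 = 2 e\<close> vertices, so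
  \<open>2 e \<le> n\<close> (\<open>twice_hops_le_order\<close>).

  On the cycle this is sharp. Any integer function on the vertices that grows by at most one along
  each arc bounds distances from below (\<open>potential_le_graph_dist\<close>). On the labels \<open>0, \<dots>, n - 1\<close> of
  the cycle the circular distance \<open>min \<bar>x - c\<bar> (n - \<bar>x - c\<bar>)\<close> from \<open>c\<close> is such a function, and it
  takes the value \<open>n div 2\<close> at a label opposite to \<open>c\<close>. Reading the labels through an isomorphism
  avoids any comparison of distances in the two graphs.
\<close>

section \<open>Distances and potentials\<close>

text \<open>
  The distance as a natural number, so that levels can be counted; the value is arbitrary where no
  walk exists.
\<close>
definition (in pre_digraph) hops :: "'a \<Rightarrow> 'a \<Rightarrow> nat" where
  "hops u v = (LEAST k. \<exists>p. awalk u p v \<and> length p = k)"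

context wf_digraph
begin

lemma hops_le_length: "awalk u p v \<Longrightarrow> hops u v \<le> length p"
  unfolding hops_def by (rule Least_le) blast

lemma hops_walk:
  assumes "u \<rightarrow>\<^sup>* v"
  obtains p where "awalk u p v" "length p = hops u v"
proof -
  obtain q where "awalk u q v"
    using assms by (auto simp: reachable_awalk)
  then have "\<exists>k. \<exists>p. awalk u p v \<and> length p = k"
    by blast
  from LeastI_ex[OF this] have "\<exists>p. awalk u p v \<and> length p = hops u v"
    unfolding hops_def .
  then show thesis
    using that by blast
qed

lemma hops_self: "v \<in> verts G \<Longrightarrow> hops v v = 0"
  using hops_le_length[of v "[]" v] by (simp add: awalk_Nil_iff)

lemma hops_head_le:
  assumes "v \<rightarrow>\<^sup>* tail G a" and "a \<in> arcs G"
  shows "hops v (head G a) \<le> Suc (hops v (tail G a))"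
proof -
  obtain p where p: "awalk v p (tail G a)" "length p = hops v (tail G a)"
    using assms(1) by (rule hops_walk)
  have "awalk v (p @ [a]) (head G a)"
    using p(1) assms(2) by (auto intro: arc_implies_awalk)
  from hops_le_length[OF this] p(2) show ?thesis
    by simp
qed

lemma unit_awalk_cost: "awalk_cost (\<lambda>_. 1) p = real (length p)"
  by (induction p) auto

lemma graph_dist_le_hops:
  assumes "u \<rightarrow>\<^sup>* v"
  shows "graph_dist G u v \<le> ereal (real (hops u v))"
proof -
  obtain p where "awalk u p v" "length p = hops u v"
    using assms by (rule hops_walk)
  then show ?thesis
    using min_cost_le_walk_cost[of u p v "\<lambda>_. 1"] by (simp add: graph_dist_def unit_awalk_cost)
qed

text \<open>
  Along a walk with \<open>k\<close> arcs the potential rises by at most \<open>k\<close>, so no walk from \<open>u\<close> to \<open>v\<close> can be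
  shorter than the difference of potentials.
\<close>
lemma potential_le_graph_dist:
  fixes \<phi> :: "'a \<Rightarrow> int"
  assumes step: "\<And>a. a \<in> arcs G \<Longrightarrow> \<phi> (head G a) \<le> \<phi> (tail G a) + 1"
  shows "ereal (of_int (\<phi> v - \<phi> u)) \<le> graph_dist G u v"
proof -
  have "\<phi> v \<le> \<phi> u + int (length p)" if "awalk u p v" for p
    using that
  proof (induction p arbitrary: u)
    case Nil
    then show ?case by (simp add: awalk_Nil_iff)
  next
    case (Cons a p)
    then have "a \<in> arcs G" "u = tail G a" "awalk (head G a) p v"
      by (auto simp: awalk_Cons_iff)
    with Cons.IH[of "head G a"] step[of a] show ?case
      by simp
  qed
  then have "of_int (\<phi> v - \<phi> u) \<le> real (length p)" if "awalk u p v" for p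
    using that by fastforce
  then show ?thesis
    unfolding graph_dist_def \<mu>_def by (intro INF_greatest) (simp add: unit_awalk_cost)
qed

section \<open>Levels in a graph without cut vertices\<close>

text \<open>
  A discrete intermediate value theorem. Connectedness of a digraph ignores the direction of arcs,
  so the step condition is two-sided.
\<close>
lemma connected_meets_level:
  fixes \<phi> :: "'a \<Rightarrow> nat"
  assumes "connected G" and "u \<in> verts G" "v \<in> verts G"
    and step: "\<And>a. a \<in> arcs G \<Longrightarrow>
      \<phi> (head G a) \<le> Suc (\<phi> (tail G a)) \<and> \<phi> (tail G a) \<le> Suc (\<phi> (head G a))"
    and "\<phi> u \<le> i" "i \<le> \<phi> v"
  obtains x where "x \<in> verts G" "\<phi> x = i"
proof -
  have "(u, v) \<in> rtrancl_on (verts G) ((arcs_ends G)\<^sup>s)"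
    using assms(1-3) by (simp add: connected_conv)
  then have "i \<le> \<phi> v \<longrightarrow> (\<exists>x \<in> verts G. \<phi> x = i)"
  proof (induction rule: rtrancl_on_induct)
    case base
    then show ?case
      using \<open>u \<in> verts G\<close> \<open>\<phi> u \<le> i\<close> by (metis le_antisym)
  next
    case (step y z)
    then have "\<phi> z \<le> Suc (\<phi> y)"
      using assms(4) by (auto simp: symcl_def arcs_ends_conv)
    with step show ?case
      by (metis le_Suc_eq le_antisym le_trans not_less_eq_eq)
  qed
  then show thesis
    using that \<open>i \<le> \<phi> v\<close> by blast
qed

end

context graph
begin

lemma connected_reachable:
  assumes "connected G" "u \<in> verts G" "v \<in> verts G"
  shows "u \<rightarrow>\<^sup>* v"
  using symmetric_connected_imp_strongly_connected[OF sym_arcs assms(1)] assms(2,3)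
  by (auto simp: strongly_connected_def)

lemma hops_step:
  assumes "connected G" "v \<in> verts G" "a \<in> arcs G"
  shows "hops v (head G a) \<le> Suc (hops v (tail G a)) \<and> hops v (tail G a) \<le> Suc (hops v (head G a))"
proof -
  obtain b where "b \<in> arcs G" "tail G b = head G a" "head G b = tail G a"
    using sym_arcs \<open>a \<in> arcs G\<close>
    by (force simp: symmetric_def arcs_ends_conv dest: symD[of _ "tail G a" "head G a"])
  then show ?thesis
    using hops_head_le[of v a] hops_head_le[of v b] connected_reachable assms by auto
qed

text \<open>
  The whole graph meets the level in some \<open>w\<close>; the graph without \<open>w\<close>, still connected, meets it
  again. The level is strictly inner, so that \<open>w\<close> is neither of the end points \<open>v\<close> and \<open>u\<close>.
\<close>
lemma inner_level_two_vertices: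
  assumes conn: "connected G" and no_cut: "\<And>w. \<not> cut_vertex G w"
    and vu: "v \<in> verts G" "u \<in> verts G" and i: "0 < i" "i < hops v u"
  shows "2 \<le> card {x \<in> verts G. hops v x = i}"
proof -
  note step = hops_step[OF conn vu(1)]
  have ends: "hops v v \<le> i" "i \<le> hops v u"
    using i vu(1) by (simp_all add: hops_self)
  obtain w where w: "w \<in> verts G" "hops v w = i"
    using connected_meets_level[of v u "hops v" i] conn vu step ends by blast
  have vu_del: "v \<in> verts (del_vert w)" "u \<in> verts (del_vert w)"
    using w i vu by (auto simp: verts_del_vert hops_self)
  then have conn_del: "connected (del_vert w)"
    using no_cut[of w] w(1) by (auto simp: cut_vertex_def)
  interpret D: wf_digraph "del_vert w"
    by (rule wf_digraph_del_vert)
  obtain x where x: "x \<in> verts (del_vert w)" "hops v x = i"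
    using D.connected_meets_level[of v u "hops v" i] conn_del vu_del step ends
    by (auto simp: del_vert_simps)
  then have "x \<noteq> w" "{x, w} \<subseteq> {x \<in> verts G. hops v x = i}"
    using w by (auto simp: verts_del_vert)
  moreover have "finite {x \<in> verts G. hops v x = i}"
    by simp
  ultimately show ?thesis
    using card_mono[of "{x \<in> verts G. hops v x = i}" "{x, w}"] by simp
qed

lemma twice_hops_le_order:
  assumes conn: "connected G" and no_cut: "\<And>w. \<not> cut_vertex G w"
    and vu: "v \<in> verts G" "u \<in> verts G"
  shows "2 * hops v u \<le> card (verts G)"
proof (cases "hops v u = 0")
  case False
  define L where "L i = {x \<in> verts G. hops v x = i}" for i
  define inner where "inner = (\<Union>i\<in>{1..<hops v u}. L i)"
  have "2 * (hops v u - 1) = (\<Sum>i\<in>{1..<hops v u}. 2)"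
    by simp
  also have "\<dots> \<le> (\<Sum>i\<in>{1..<hops v u}. card (L i))"
    unfolding L_def by (intro sum_mono inner_level_two_vertices[where u = u] assms) auto
  also have "\<dots> = card inner"
    unfolding inner_def by (intro card_UN_disjoint[symmetric]) (auto simp: L_def)
  finally have "2 * (hops v u - 1) \<le> card inner" .
  moreover have "card (insert v (insert u inner)) = Suc (Suc (card inner))"
  proof -
    have "finite inner" "u \<notin> inner" "v \<notin> insert u inner"
      using False vu by (auto simp: inner_def L_def hops_self)
    then show ?thesis by simp
  qed
  moreover have "card (insert v (insert u inner)) \<le> card (verts G)"
    using vu by (intro card_mono) (auto simp: inner_def L_def)
  ultimately show ?thesis
    using False by simp
qed simp

lemma eccentricity_le_half:
  assumes "connected G" and "\<And>w. \<not> cut_vertex G w" and v: "v \<in> verts G"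
  shows "eccentricity G v \<le> ereal (real (card (verts G) div 2))"
proof -
  have "graph_dist G v u \<le> ereal (real (card (verts G) div 2))" if "u \<in> verts G" for u
  proof -
    have "hops v u \<le> card (verts G) div 2"
      using twice_hops_le_order[OF assms that] by simp
    then show ?thesis
      using graph_dist_le_hops[OF connected_reachable[OF assms(1) v that]]
      by (meson ereal_less_eq(3) of_nat_mono order_trans)
  qed
  then show ?thesis
    unfolding eccentricity_def using v by (subst Max_le_iff) auto
qed

end

section \<open>Cycles\<close>

text \<open>
  For \<open>c, x < n\<close> this is the length of the shorter way round a circle with \<open>n\<close> points.
\<close>
definition circular_dist :: "nat \<Rightarrow> nat \<Rightarrow> nat \<Rightarrow> int" where
  "circular_dist n c x = min \<bar>int x - int c\<bar> (int n - \<bar>int x - int c\<bar>)"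

lemma circular_dist_step:
  assumes "c < n" "x < n" "y < n" and "y = Suc x mod n \<or> x = Suc y mod n"
  shows "circular_dist n c y \<le> circular_dist n c x + 1"
proof -
  have succ: "b = Suc a \<or> Suc a = n \<and> b = 0" if "a < n" "b = Suc a mod n" for a b
    using that by (cases "Suc a = n") auto
  have "y = Suc x \<or> x = Suc y \<or> (Suc x = n \<and> y = 0) \<or> (Suc y = n \<and> x = 0)"
    using assms succ[of x y] succ[of y x] by auto
  then show ?thesis
    using assms(1-3) unfolding circular_dist_def by (elim disjE) auto
qed

lemma opposite_label:
  assumes "c < n"
  obtains x where "x < n" "circular_dist n c x = int (n div 2)"
proof (cases "c + n div 2 < n")
  case True
  then show thesis
    by (intro that[of "c + n div 2"]) (auto simp: circular_dist_def)
next
  case False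
  with assms show thesis
    by (intro that[of "c - n div 2"]) (auto simp: circular_dist_def)
qed

lemma (in fin_digraph) cycle_eccentricity_ge_half:
  assumes iso: "digraph_iso G (cycle_graph n)" and v: "v \<in> verts G"
  shows "ereal (real (n div 2)) \<le> eccentricity G v"
proof -
  obtain f where f: "digraph_isomorphism f" and cyc: "cycle_graph n = app_iso f G"
    using iso by (auto simp: digraph_iso_def)
  let ?l = "iso_verts f"
  let ?\<phi> = "\<lambda>x. circular_dist n (?l v) (?l x)"
  have labels: "?l ` verts G = {..<n}"
    using arg_cong[OF cyc, of verts] by (simp add: cycle_graph_def)
  have step: "?\<phi> (head G a) \<le> ?\<phi> (tail G a) + 1" if a: "a \<in> arcs G" for a
  proof -
    have "iso_arcs f a \<in> arcs (cycle_graph n)"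
      using a by (simp add: cyc)
    moreover have "iso_arcs f a = (?l (tail G a), ?l (head G a))"
      using arg_cong[OF cyc, of tail] arg_cong[OF cyc, of head]
        iso_verts_tail[OF f a] iso_verts_head[OF f a]
      by (simp add: cycle_graph_def prod_eq_iff)
    ultimately show ?thesis
      using v labels by (intro circular_dist_step) (auto simp: cycle_graph_def)
  qed
  obtain u where u: "u \<in> verts G" "?\<phi> u = int (n div 2)"
  proof -
    obtain x where "x < n" "circular_dist n (?l v) x = int (n div 2)"
      using opposite_label[of "?l v" n] v labels by blast
    then show thesis
      using that labels by (metis imageE lessThan_iff)
  qed
  have "?\<phi> v = 0"
    by (simp add: circular_dist_def)
  then have "ereal (real (n div 2)) \<le> graph_dist G v u"
    using potential_le_graph_dist[of ?\<phi> u v, OF step] u(2) by simp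
  also have "\<dots> \<le> eccentricity G v"
    unfolding eccentricity_def using u(1) by (intro Max_ge) auto
  finally show ?thesis .
qed

section \<open>The total eccentricity index\<close>

theorem theorem4p6:
  fixes G :: "('a, 'b) pre_digraph" and n :: nat
  assumes "n \<ge> 3"
    and "G \<in> cut_vertex_graphs n 0"
  shows "total_eccentricity G \<le> ereal (real (n * (n div 2))) \<and>
    (digraph_iso G (cycle_graph n) \<longrightarrow>
      total_eccentricity G = ereal (real (n * (n div 2))))"
proof -
  from assms(2) have "graph G" and conn: "connected G" and order: "card (verts G) = n"
    and card_cut: "card {w. cut_vertex G w} = 0"
    by (auto simp: cut_vertex_graphs_def)
  interpret graph G by fact
  \<comment> \<open>Cardinality 0 means emptiness only because the set is finite.\<close>
  have "finite {w. cut_vertex G w}"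
    by (rule finite_subset[of _ "verts G"]) (auto simp: cut_vertex_def)
  with card_cut have no_cut: "\<not> cut_vertex G w" for w
    by auto
  have const: "(\<Sum>v\<in>verts G. ereal (real (n div 2))) = ereal (real (n * (n div 2)))"
    by (simp add: order)
  have le: "total_eccentricity G \<le> ereal (real (n * (n div 2)))"
    unfolding total_eccentricity_def const[symmetric]
    using eccentricity_le_half[OF conn no_cut] order by (intro sum_mono) simp
  moreover have "ereal (real (n * (n div 2))) \<le> total_eccentricity G"
    if "digraph_iso G (cycle_graph n)"
    unfolding total_eccentricity_def const[symmetric]
    by (intro sum_mono cycle_eccentricity_ge_half that)
  ultimately show ?thesis
    by (auto intro: antisym)
qed

end
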